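(* Up to renaming of variables, the only minimally avoidable formula with exactly one fragment is $AA$.
   Context: Variables are letters of an alphabet $\Delta=\{A,B,C,\dots\}$. A formula is a finite set of non-empty words over $\Delta$, called fragments, written separated by dots; by convention every variable of a formula occurs at least twice in total (no isolated variable) and no fragment is a factor of another fragment. An occurrence of a formula $f$ in a word $w$ over an alphabet $\Sigma$ is a non-erasing morphism $h:\Delta^*\to\Sigma^*$ such that $h(\phi)$ is a factor of $w$ for every fragment $\phi$; $f$ is avoidable if for some finite alphabet there is an infinite word containing no occurrence of $f$, and unavoidable otherwise. Splitting a formula on a fragment $\phi$ means replacing $\phi$ by two fragments, namely the prefix and the suffix of $\phi$ of length $|\phi|-1$. A formula is minimally avoidable if it is avoidable and splitting it on any of its fragments yields an unavoidable formula. *)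

theory Defs
  imports Main "HOL-Library.Sublist"
begin

definition vars :: "'v list set \<Rightarrow> 'v set" where
  "vars f = (\<Union>\<phi>\<in>f. set \<phi>)"

text \<open>
  The predicate \<open>formula\<close> includes the standing conventions (no isolated variable, no fragment a
  factor of another). The notions of occurrence, avoidability and splitting below make sense for
  arbitrary sets of words; this matters because splitting need not preserve the conventions
  (e.g. splitting \<open>AA\<close> yields \<open>A\<close>).
\<close>

definition formula :: "'v list set \<Rightarrow> bool" where
  "formula f \<longleftrightarrow> finite f \<and> [] \<notin> f
     \<and> (\<forall>v\<in>vars f. 2 \<le> (\<Sum>\<phi>\<in>f. count_list \<phi> v))
     \<and> (\<forall>\<phi>\<in>f. \<forall>\<psi>\<in>f. \<phi> \<noteq> \<psi> \<longrightarrow> \<not> sublist \<phi> \<psi>)"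

definition factor_of :: "'s list \<Rightarrow> (nat \<Rightarrow> 's) \<Rightarrow> bool" where
  "factor_of u w \<longleftrightarrow> (\<exists>i. u = map w [i..<i + length u])"

text \<open>A morphism of free monoids is given by the images of the letters.\<close>

definition morph :: "('v \<Rightarrow> 's list) \<Rightarrow> 'v list \<Rightarrow> 's list" where
  "morph h u = concat (map h u)"

definition occurrence :: "'s set \<Rightarrow> ('v \<Rightarrow> 's list) \<Rightarrow> 'v list set \<Rightarrow> (nat \<Rightarrow> 's) \<Rightarrow> bool" where
  "occurrence \<Sigma> h f w \<longleftrightarrow>
     (\<forall>v. h v \<in> lists \<Sigma> \<and> h v \<noteq> []) \<and> (\<forall>\<phi>\<in>f. factor_of (morph h \<phi>) w)"

text \<open>Finite alphabets are, without loss of generality, finite sets of natural numbers.\<close>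

definition avoidable :: "'v list set \<Rightarrow> bool" where
  "avoidable f \<longleftrightarrow> (\<exists>(\<Sigma> :: nat set) w.
     finite \<Sigma> \<and> range w \<subseteq> \<Sigma> \<and> \<not> (\<exists>h. occurrence \<Sigma> h f w))"

definition split_on :: "'v list \<Rightarrow> 'v list set \<Rightarrow> 'v list set" where
  "split_on \<phi> f = (f - {\<phi>}) \<union> {butlast \<phi>, tl \<phi>}"

definition minimally_avoidable :: "'v list set \<Rightarrow> bool" where
  "minimally_avoidable f \<longleftrightarrow> avoidable f \<and> (\<forall>\<phi>\<in>f. \<not> avoidable (split_on \<phi> f))"

definition renaming_of :: "'v list set \<Rightarrow> 'v list set \<Rightarrow> bool" where
  "renaming_of g f \<longleftrightarrow> (\<exists>\<pi>. bij_betw \<pi> (vars f) (vars g) \<and> g = map \<pi> ` f)"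

end

theory Submission imports Defs begin

text \<open>
  Let \<open>w\<close> be the fixed point of the morphism \<open>(i,j) \<mapsto> (0,i)(1,j)(2,i)(3,j)\<dots>\<close> of length \<open>m\<close> on
  \<open>{0..<m} \<times> {0..<m}\<close>. A letter of \<open>w\<close> reveals its position modulo \<open>m\<close>, and any two adjacent
  letters inside a block reveal the letter of which the block is the image. If \<open>m\<close> is large compared
  with the number of variables, an occurrence \<open>h\<close> leaves some residue \<open>c > 0\<close> such that no variable
  image ends right before a position congruent to \<open>c\<close>. Assigning each block to the variable covering
  its positions \<open>c - 1\<close> and \<open>c\<close> desubstitutes \<open>h\<close> to a shorter, possibly erasing, \<open>h'\<close>; a run of
  erased variables lies in a window of length less than \<open>m\<close>, hence repeats no variable. Deleting the
  erased variables therefore leads from each of the following situations to a smaller instance of one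
  of them, and infinite descent excludes both: a nonempty word \<open>\<phi>\<close> with every variable repeated occurs
  in \<open>w\<close>; both parts of the splitting of such a word \<open>\<phi>\<close> of length at least 3 occur in \<open>w\<close>. The first
  gives avoidability of \<open>AA\<close>, the second excludes all longer words.
\<close>

section \<open>The self-similar word\<close>

text \<open>The pair \<open>(i,j)\<close> is coded as \<open>i * m + j\<close>.\<close>

fun block_word :: "nat \<Rightarrow> nat \<Rightarrow> nat" where
  "block_word m n = (if n = 0 \<or> m < 2 then 0 else
     (n mod m) * m + (if even (n mod m) then block_word m (n div m) div m
                      else block_word m (n div m) mod m))"

declare block_word.simps [simp del]

lemma block_word_less:
  assumes "2 \<le> m"
  shows "block_word m n < m * m"
proof (induction n rule: less_induct)
  case (less n)
  show ?case
  proof (cases "n = 0")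
    case True
    then show ?thesis using assms by (simp add: block_word.simps)
  next
    case False
    then have "block_word m (n div m) < m * m"
      using less assms by simp
    then have d: "(if even (n mod m) then block_word m (n div m) div m
        else block_word m (n div m) mod m) < m" (is "?d < m")
      using assms by (simp add: less_mult_imp_div_less)
    have "n mod m + 1 \<le> m" using assms by (simp add: Suc_leI)
    then have "(n mod m + 1) * m \<le> m * m" by (rule mult_le_mono1)
    moreover have "block_word m n = (n mod m) * m + ?d"
      using False assms by (subst block_word.simps) simp
    ultimately show ?thesis using d by simp
  qed
qed

text \<open>The recursion equation also covers position 0, where the definition stops: the pair
  (0,0) there is its own parent.\<close>

lemma block_word_coordinates:
  assumes "2 \<le> m"
  shows "block_word m n div m = n mod m"
    and "block_word m n mod m = (if even (n mod m) then block_word m (n div m) div m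
           else block_word m (n div m) mod m)"
proof -
  have "block_word m (n div m) < m * m" using block_word_less assms by blast
  then have d: "(if even (n mod m) then block_word m (n div m) div m
      else block_word m (n div m) mod m) < m" (is "?d < m")
    using assms by (simp add: less_mult_imp_div_less)
  have "block_word m n = (n mod m) * m + ?d"
  proof (cases "n = 0")
    case True
    then show ?thesis by (simp add: block_word.simps)
  next
    case False
    then show ?thesis using assms by (subst block_word.simps) simp
  qed
  then show "block_word m n div m = n mod m" "block_word m n mod m = ?d"
    using d assms by simp_all
qed

lemma block_word_eq_mod:
  assumes "2 \<le> m" "block_word m i = block_word m j"
  shows "i mod m = j mod m"
  using block_word_coordinates(1)[OF assms(1)] assms(2) by metis

text \<open>As \<open>c\<close> is positive, the indices \<open>c - 1\<close> and \<open>c\<close>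
  lie in one block. Their parities differ, so one letter carries the first coordinate of the parent
  and the other the second.\<close>

lemma block_word_decode:
  assumes m: "2 \<le> m" and c: "0 < c" "c < m"
    and 1: "block_word m (m * b + c - 1) = block_word m (m * b' + c - 1)"
    and 2: "block_word m (m * b + c) = block_word m (m * b' + c)"
  shows "block_word m b = block_word m b'"
proof -
  obtain d where d: "c = Suc d" using c by (cases c) auto
  have E: "block_word m (m * x + e) mod m =
      (if even e then block_word m x div m else block_word m x mod m)" if "e < m" for x e
    using block_word_coordinates(2)[OF m, of "m * x + e"] that by simp
  have "(if even d then block_word m b div m else block_word m b mod m) =
      (if even d then block_word m b' div m else block_word m b' mod m)"
    using E[of d b] E[of d b'] 1 c d by simp
  moreover have "(if even c then block_word m b div m else block_word m b mod m) =
      (if even c then block_word m b' div m else block_word m b' mod m)"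
    using E[of c b] E[of c b'] 2 c by simp
  ultimately have "block_word m b div m = block_word m b' div m"
    "block_word m b mod m = block_word m b' mod m"
    using d by (auto split: if_splits)
  then show ?thesis by (metis div_mult_mod_eq)
qed

section \<open>Desubstitution\<close>

text \<open>The least block whose positions \<open>c - 1\<close> and \<open>c\<close> both lie at or after \<open>i\<close>.\<close>

definition first_block :: "nat \<Rightarrow> nat \<Rightarrow> nat \<Rightarrow> nat" where
  "first_block m c i = (i + m - c) div m"

lemma first_block_mono: "i \<le> j \<Longrightarrow> first_block m c i \<le> first_block m c j"
  unfolding first_block_def by (simp add: div_le_mono)

lemma first_block_add_mult:
  assumes "0 < m" "c < m"
  shows "first_block m c (i + m * t) = first_block m c i + t"
proof -
  have "i + m * t + m - c = (i + m - c) + m * t" using assms by simp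
  then show ?thesis unfolding first_block_def using assms by (simp only: div_mult_self2)
qed

lemma first_block_leD:
  assumes "c < m" "first_block m c i \<le> b"
  shows "i < m * b + c"
proof -
  have "(i + m - c) div m < Suc b" using assms by (simp add: first_block_def)
  then have "i + m - c < Suc b * m" using assms by (subst (asm) div_less_iff_less_mult) auto
  then show ?thesis using assms by (simp add: algebra_simps)
qed

text \<open>The bound on \<open>b\<close> only puts position \<open>m * b + c - 1\<close> before
  \<open>j\<close>. As \<open>j\<close> is not congruent to \<open>c\<close>, it cannot separate
  that position from the next.\<close>

lemma less_first_blockD:
  assumes "c < m" "b < first_block m c j" "j mod m \<noteq> c"
  shows "m * b + c < j"
proof -
  have "Suc b \<le> (j + m - c) div m" using assms by (simp add: first_block_def)
  then have "Suc b * m \<le> j + m - c" using assms by (subst (asm) less_eq_div_iff_mult_less_eq) auto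
  then have "m * b + c \<le> j" using assms by (simp add: algebra_simps)
  moreover have "m * b + c \<noteq> j" using assms by auto
  ultimately show ?thesis by simp
qed

text \<open>Each assigned block has its positions \<open>c - 1\<close> and \<open>c\<close> in the
  window from \<open>i\<close> to \<open>j\<close>, so there are fewer blocks than letters. This
  strict decrease drives the descent.\<close>

lemma first_block_diff_less:
  assumes "c < m" "j mod m \<noteq> c" "i < j"
  shows "first_block m c j - first_block m c i < j - i"
proof (cases "first_block m c j \<le> first_block m c i")
  case True
  then show ?thesis using assms by simp
next
  case False
  let ?a = "first_block m c i" and ?b = "first_block m c j - 1"
  have "i < m * ?a + c" using first_block_leD[OF assms(1)] by simp
  moreover have "m * ?b + c < j"
    using less_first_blockD[OF assms(1) _ assms(2)] False by simp
  moreover have "?b - ?a \<le> m * (?b - ?a)" using assms by simp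
  moreover have "m * (?b - ?a) = m * ?b - m * ?a" by (rule diff_mult_distrib2)
  moreover have "m * ?a \<le> m * ?b" using False by (intro mult_le_mono2) simp
  ultimately show ?thesis using False by linarith
qed

text \<open>A shift by \<open>m\<close> raises \<open>first_block\<close> by one, so a window that
  receives no block is shorter than \<open>m\<close>.\<close>

lemma first_block_eq_diff_less:
  assumes "c < m" "first_block m c i = first_block m c j"
  shows "j < i + m"
proof (rule ccontr)
  assume "\<not> j < i + m"
  then have "first_block m c (i + m * 1) \<le> first_block m c j"
    by (intro first_block_mono) simp
  then show False using first_block_add_mult[of m c i 1] assms by simp
qed

text \<open>Equal factors begin at congruent positions, hence differ by a shift of whole blocks, and
  each assigned block can be decoded inside the factor. So desubstitution does not depend on the
  occurrence chosen.\<close>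

lemma blocks_determined:
  assumes m: "2 \<le> m" and c: "0 < c" "c < m" and n: "0 < n" and "(i + n) mod m \<noteq> c"
    and eq: "map (block_word m) [i..<i + n] = map (block_word m) [j..<j + n]"
  shows "map (block_word m) [first_block m c i..<first_block m c (i + n)] =
         map (block_word m) [first_block m c j..<first_block m c (j + n)]"
proof -
  have *: "block_word m (i + k) = block_word m (j + k)" if "k < n" and "map (block_word m) [i..<i + n] = map (block_word m) [j..<j + n]" for i j k
    using arg_cong[OF that(2), of "\<lambda>l. l ! k"] \<open>k < n\<close> by simp
  have main: "map (block_word m) [first_block m c i..<first_block m c (i + n)] =
         map (block_word m) [first_block m c j..<first_block m c (j + n)]"
    if eq: "map (block_word m) [i..<i + n] = map (block_word m) [j..<j + n]"
      and r: "(i + n) mod m \<noteq> c" and "i \<le> j" for i j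
  proof -
    have "i mod m = j mod m"
      using block_word_eq_mod[OF m *[OF n eq]] n by simp
    then obtain t where t: "j = i + m * t"
      using \<open>i \<le> j\<close> by (metis mod_eq_nat1E)
    have fi: "first_block m c j = first_block m c i + t"
      using first_block_add_mult[of m c i t] c t by simp
    have fn: "first_block m c (j + n) = first_block m c (i + n) + t"
      using first_block_add_mult[of m c "i + n" t] c t by (simp add: ac_simps)
    have "block_word m b = block_word m (b + t)"
      if "first_block m c i \<le> b" "b < first_block m c (i + n)" for b
    proof (rule block_word_decode[OF m c])
      have lo: "i < m * b + c" using first_block_leD[OF c(2) that(1)] .
      have hi: "m * b + c < i + n" using less_first_blockD[OF c(2) that(2) r] .
      have e: "j + (m * b + c - i) = m * (b + t) + c"
        using lo t by (simp add: algebra_simps)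
      show "block_word m (m * b + c) = block_word m (m * (b + t) + c)"
        using *[OF _ eq, of "m * b + c - i"] lo hi e by simp
      have e': "j + (m * b + c - 1 - i) = m * (b + t) + c - 1"
        using lo t c by (simp add: algebra_simps)
      show "block_word m (m * b + c - 1) = block_word m (m * (b + t) + c - 1)"
        using *[OF _ eq, of "m * b + c - 1 - i"] lo hi e' by simp
    qed
    then show ?thesis
      unfolding fi fn by (intro nth_equalityI) (simp_all add: add.commute add.left_commute)
  qed
  show ?thesis
  proof (cases "i \<le> j")
    case True
    then show ?thesis using main eq assms(5) by blast
  next
    case False
    \<comment> \<open>Both factors end at the same residue, so their roles can be exchanged.\<close>
    have "i mod m = j mod m"
      using block_word_eq_mod[OF m *[OF n eq]] n by simp
    then have "(j + n) mod m \<noteq> c" using assms(5) by (metis mod_add_left_eq)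
    then show ?thesis using main[OF eq[symmetric]] False by simp
  qed
qed

lemma morph_simps [simp]:
  "morph h [] = []" "morph h (a # u) = h a @ morph h u" "morph h (u @ v) = morph h u @ morph h v"
  by (simp_all add: morph_def)

lemma map_upt_append_eqD:
  assumes "u @ v = map w [i..<i + length (u @ v)]"
  shows "u = map w [i..<i + length u]"
    and "v = map w [i + length u..<i + length u + length v]"
proof -
  have "[i..<i + length (u @ v)] = [i..<i + length u] @ [i + length u..<i + length u + length v]"
    using upt_add_eq_append[of i "i + length u" "length v"] by (simp add: add.assoc)
  then have "u @ v = map w [i..<i + length u] @ map w [i + length u..<i + length u + length v]"
    using assms by simp
  then show "u = map w [i..<i + length u]" "v = map w [i + length u..<i + length u + length v]"
    by (subst (asm) append_eq_append_conv; simp)+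
qed

lemma factor_of_appendD:
  assumes "factor_of (u @ v) w"
  shows "factor_of u w" "factor_of v w"
  using assms map_upt_append_eqD unfolding factor_of_def by blast+

lemma factor_of_letter:
  assumes "factor_of (morph h u) w" "v \<in> set u"
  shows "factor_of (h v) w"
proof -
  obtain p q where "u = p @ v # q" using assms(2) by (meson split_list)
  then show ?thesis using assms(1) factor_of_appendD by fastforce
qed

lemma desubstitution:
  fixes V :: "'v set" and h :: "'v \<Rightarrow> nat list"
  assumes V: "finite V" "card V + 2 \<le> m"
    and h: "\<And>v. v \<in> V \<Longrightarrow> h v \<noteq> []" "\<And>v. v \<in> V \<Longrightarrow> factor_of (h v) (block_word m)"
  obtains h' where "\<And>v. v \<in> V \<Longrightarrow> length (h' v) < length (h v)"
    and "\<And>u. set u \<subseteq> V \<Longrightarrow> factor_of (morph h u) (block_word m) \<Longrightarrow>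
           factor_of (morph h' u) (block_word m)"
    and "\<And>u. set u \<subseteq> V \<Longrightarrow> factor_of (morph h u) (block_word m) \<Longrightarrow>
           \<forall>v\<in>set u. h' v = [] \<Longrightarrow> distinct u"
proof -
  let ?w = "block_word m"
  have m: "2 \<le> m" using V by simp
  from h(2) obtain p where p: "\<And>v. v \<in> V \<Longrightarrow> h v = map ?w [p v..<p v + length (h v)]"
    unfolding factor_of_def by metis
  \<comment> \<open>Images end at no more than \<open>card V\<close> residues, while 1 to
    \<open>m - 1\<close> are at least \<open>card V + 1\<close> candidates. Residue 0 is excluded
    because \<open>c - 1\<close> and \<open>c\<close> must index the same block.\<close>
  let ?S = "(\<lambda>v. (p v + length (h v)) mod m) ` V"
  have "card ?S < card {1..<m}"
    using card_image_le[OF V(1), of "\<lambda>v. (p v + length (h v)) mod m"] V(2) by simp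
  then have "\<not> {1..<m} \<subseteq> ?S" using card_mono[of ?S "{1..<m}"] V(1) by auto
  then obtain c where "c \<in> {1..<m}" "c \<notin> ?S" by blast
  then have c: "0 < c" "c < m"
    and cS: "\<And>v. v \<in> V \<Longrightarrow> (p v + length (h v)) mod m \<noteq> c"
    by auto
  define \<beta> where "\<beta> = first_block m c"
  define h' where "h' v = map ?w [\<beta> (p v)..<\<beta> (p v + length (h v))]" for v
  have start: "i mod m = p v mod m"
    if "v \<in> V" "h v = map ?w [i..<i + length (h v)]" for v i
  proof -
    have "?w i = ?w (p v)"
      using arg_cong[OF that(2), of hd] arg_cong[OF p[OF that(1)], of hd] h(1)[OF that(1)]
      by (simp add: hd_map)
    then show ?thesis by (rule block_word_eq_mod[OF m])
  qed
  \<comment> \<open>Consecutive images share a boundary, so their block intervals abut and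
    concatenate.\<close>
  have image: "morph h' u = map ?w [\<beta> i..<\<beta> (i + length (morph h u))]"
    if "set u \<subseteq> V" "morph h u = map ?w [i..<i + length (morph h u)]" for u i
    using that
  proof (induction u arbitrary: i)
    case Nil
    then show ?case by simp
  next
    case (Cons a u)
    let ?n = "length (h a)" and ?k = "length (morph h u)"
    have a: "a \<in> V" and u: "set u \<subseteq> V" using Cons.prems by auto
    have ha: "h a = map ?w [i..<i + ?n]" and hu: "morph h u = map ?w [i + ?n..<i + ?n + ?k]"
      using map_upt_append_eqD[of "h a" "morph h u" ?w i] Cons.prems(2) by simp_all
    have "map ?w [p a..<p a + ?n] = map ?w [i..<i + ?n]"
      using ha p[OF a] by simp
    then have "h' a = map ?w [\<beta> i..<\<beta> (i + ?n)]"
      unfolding h'_def \<beta>_def using blocks_determined[OF m c _ cS[OF a]] h(1)[OF a] by simp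
    moreover have "morph h' u = map ?w [\<beta> (i + ?n)..<\<beta> (i + ?n + ?k)]"
      using Cons.IH[OF u hu] .
    moreover have "\<beta> i \<le> \<beta> (i + ?n)" "\<beta> (i + ?n) \<le> \<beta> (i + ?n + ?k)"
      unfolding \<beta>_def by (auto intro: first_block_mono)
    then have "[\<beta> i..<\<beta> (i + ?n + ?k)] = [\<beta> i..<\<beta> (i + ?n)] @ [\<beta> (i + ?n)..<\<beta> (i + ?n + ?k)]"
      using upt_add_eq_append[of "\<beta> i" "\<beta> (i + ?n)" "\<beta> (i + ?n + ?k) - \<beta> (i + ?n)"] by simp
    ultimately show ?case by (simp add: add.assoc)
  qed
  show ?thesis
  proof (rule that[of h'])
    fix v assume v: "v \<in> V"
    show "length (h' v) < length (h v)"
      using first_block_diff_less[OF c(2) cS[OF v], of "p v"] h(1)[OF v]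
      by (simp add: h'_def \<beta>_def)
  next
    fix u assume "set u \<subseteq> V" "factor_of (morph h u) ?w"
    then obtain i where "morph h' u = map ?w [\<beta> i..<\<beta> (i + length (morph h u))]"
      using image unfolding factor_of_def by blast
    moreover have "\<beta> i \<le> \<beta> (i + length (morph h u))"
      unfolding \<beta>_def by (simp add: first_block_mono)
    ultimately show "factor_of (morph h' u) ?w"
      unfolding factor_of_def by (intro exI[of _ "\<beta> i"]) simp
  next
    fix u assume u: "set u \<subseteq> V" "factor_of (morph h u) ?w" "\<forall>v\<in>set u. h' v = []"
    then obtain i where i: "morph h u = map ?w [i..<i + length (morph h u)]"
      unfolding factor_of_def by blast
    have "morph h' u = []" using u(3) by (simp add: morph_def)
    then have "\<beta> (i + length (morph h u)) \<le> \<beta> i" using image[OF u(1) i] by auto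
    then have "\<beta> i = \<beta> (i + length (morph h u))"
      unfolding \<beta>_def by (simp add: first_block_mono le_antisym)
    then have short: "length (morph h u) < m"
      unfolding \<beta>_def using first_block_eq_diff_less[OF c(2)] by fastforce
    show "distinct u"
    \<comment> \<open>Two occurrences of \<open>h a\<close> begin at congruent positions, yet in a
      window shorter than \<open>m\<close> their distance \<open>k\<close> lies strictly between 0
      and \<open>m\<close>.\<close>
    proof (rule ccontr)
      assume "\<not> distinct u"
      then obtain x y z a where dec: "u = x @ [a] @ y @ [a] @ z"
        using not_distinct_decomp by blast
      have a: "a \<in> V" using u(1) dec by simp
      define j where "j = i + length (morph h x)"
      define k where "k = length (h a) + length (morph h y)"
      have "morph h u = morph h x @ (h a @ morph h y @ h a @ morph h z)" using dec by simp
      with i have 1: "h a @ morph h y @ h a @ morph h z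
          = map ?w [j..<j + length (h a @ morph h y @ h a @ morph h z)]"
        unfolding j_def by (metis map_upt_append_eqD(2))
      then have "h a = map ?w [j..<j + length (h a)]" by (rule map_upt_append_eqD(1))
      then have s1: "j mod m = p a mod m" by (rule start[OF a])
      have "(h a @ morph h y) @ (h a @ morph h z)
          = map ?w [j..<j + length ((h a @ morph h y) @ (h a @ morph h z))]" using 1 by simp
      then have "h a @ morph h z = map ?w [j + k..<j + k + length (h a @ morph h z)]"
        unfolding k_def using map_upt_append_eqD(2) by fastforce
      then have "h a = map ?w [j + k..<j + k + length (h a)]" by (rule map_upt_append_eqD(1))
      then have "(j + k) mod m = p a mod m" by (rule start[OF a])
      then have "(j + k) mod m = j mod m" using s1 by simp
      then have "m dvd k" using mod_eq_dvd_iff_nat[of j "j + k" m] by simp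
      moreover have "0 < k" "k < m" using short h(1)[OF a] dec unfolding k_def by auto
      ultimately show False by (simp add: nat_dvd_not_less)
    qed
  qed
qed

section \<open>Words in which every variable is repeated\<close>

text \<open>For a single fragment this is the absence of isolated variables. Deleting all
  occurrences of some variables preserves it.\<close>

definition doubled :: "'v list \<Rightarrow> bool" where
  "doubled \<phi> \<longleftrightarrow> (\<forall>v\<in>set \<phi>. 2 \<le> count_list \<phi> v)"

lemma count_list_filter: "P v \<Longrightarrow> count_list (filter P \<phi>) v = count_list \<phi> v"
  by (induction \<phi>) auto

lemma doubled_filter: "doubled \<phi> \<Longrightarrow> doubled (filter P \<phi>)"
  by (simp add: doubled_def count_list_filter)

lemma doubled_distinct_Nil: "doubled u \<Longrightarrow> distinct u \<Longrightarrow> u = []"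
  by (cases u) (auto simp: doubled_def count_list_0_iff)

lemma morph_filter_nonerased: "morph h (filter (\<lambda>v. h v \<noteq> []) \<phi>) = morph h \<phi>"
  by (induction \<phi>) auto

lemma length_morph_less:
  assumes "\<phi> \<noteq> []" "\<And>v. v \<in> set \<phi> \<Longrightarrow> length (h' v) < length (h v)"
  shows "length (morph h' \<phi>) < length (morph h \<phi>)"
  using assms
proof (induction \<phi>)
  case (Cons a \<phi>)
  then show ?case by (cases "\<phi> = []") (auto intro: add_strict_mono)
qed simp

lemma doubled_not_factor_of_block_word:
  assumes "doubled \<phi>" "\<phi> \<noteq> []" "\<And>v. v \<in> set \<phi> \<Longrightarrow> h v \<noteq> []" "card (set \<phi>) + 2 \<le> m"
  shows "\<not> factor_of (morph h \<phi>) (block_word m)"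
  using assms
proof (induction "length (morph h \<phi>)" arbitrary: h \<phi> rule: less_induct)
  case less
  let ?w = "block_word m"
  show ?case
  proof
    assume occ: "factor_of (morph h \<phi>) ?w"
    obtain h' where lt: "\<And>v. v \<in> set \<phi> \<Longrightarrow> length (h' v) < length (h v)"
      and fac: "\<And>u. set u \<subseteq> set \<phi> \<Longrightarrow> factor_of (morph h u) ?w \<Longrightarrow> factor_of (morph h' u) ?w"
      and dis: "\<And>u. set u \<subseteq> set \<phi> \<Longrightarrow> factor_of (morph h u) ?w \<Longrightarrow>
           \<forall>v\<in>set u. h' v = [] \<Longrightarrow> distinct u"
      by (rule desubstitution[where h = h, OF List.finite_set less.prems(4) less.prems(3)
            factor_of_letter[OF occ]]) blast+
    let ?\<psi> = "filter (\<lambda>v. h' v \<noteq> []) \<phi>"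
    \<comment> \<open>If every variable were erased, \<phi> would repeat none.\<close>
    have "?\<psi> \<noteq> []"
      using dis[OF subset_refl occ] doubled_distinct_Nil less.prems(1,2)
      by (auto simp: filter_empty_conv)
    moreover have "card (set ?\<psi>) \<le> card (set \<phi>)" by (intro card_mono) auto
    then have "card (set ?\<psi>) + 2 \<le> m" using less.prems(4) by linarith
    moreover have "length (morph h' ?\<psi>) < length (morph h \<phi>)"
      unfolding morph_filter_nonerased using length_morph_less less.prems(2) lt by blast
    ultimately have "\<not> factor_of (morph h' ?\<psi>) ?w"
      using less.hyps doubled_filter less.prems(1) by fastforce
    then show False using fac[OF subset_refl occ] unfolding morph_filter_nonerased by blast
  qed
qed

text \<open>The descent keeps \<open>x\<close> and \<open>y\<close> at the ends. Neither can be
  erased: the image of the whole word would then equal that of one part and occur, which the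
  preceding lemma forbids.\<close>

lemma split_doubled_not_factors_of_block_word:
  assumes "doubled (x # u @ [y])" "u \<noteq> []" "\<And>v. v \<in> set (x # u @ [y]) \<Longrightarrow> h v \<noteq> []"
    "card (set (x # u @ [y])) + 2 \<le> m"
  shows "\<not> (factor_of (morph h (x # u)) (block_word m) \<and> factor_of (morph h (u @ [y])) (block_word m))"
  using assms
proof (induction "length (morph h (x # u @ [y]))" arbitrary: h u rule: less_induct)
  case less
  let ?w = "block_word m" and ?\<phi> = "x # u @ [y]"
  show ?case
  proof
    assume "factor_of (morph h (x # u)) ?w \<and> factor_of (morph h (u @ [y])) ?w"
    then have occ1: "factor_of (morph h (x # u)) ?w" and occ2: "factor_of (morph h (u @ [y])) ?w"
      by auto
    have letter: "factor_of (h v) ?w" if "v \<in> set ?\<phi>" for v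
      using factor_of_letter[OF occ1, of v] factor_of_letter[OF occ2, of v] that by auto
    obtain h' where lt: "\<And>v. v \<in> set ?\<phi> \<Longrightarrow> length (h' v) < length (h v)"
      and fac: "\<And>u. set u \<subseteq> set ?\<phi> \<Longrightarrow> factor_of (morph h u) ?w \<Longrightarrow> factor_of (morph h' u) ?w"
      and dis: "\<And>u. set u \<subseteq> set ?\<phi> \<Longrightarrow> factor_of (morph h u) ?w \<Longrightarrow>
           \<forall>v\<in>set u. h' v = [] \<Longrightarrow> distinct u"
      by (rule desubstitution[where h = h, OF List.finite_set less.prems(4) less.prems(3) letter])
        blast+
    let ?P = "\<lambda>v. h' v \<noteq> []"
    have occ3: "factor_of (morph h u) ?w" using factor_of_appendD(2)[of "h x" "morph h u"] occ1 by simp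
    have fac1: "factor_of (morph h' (x # u)) ?w" and fac2: "factor_of (morph h' (u @ [y])) ?w"
      using fac[OF _ occ1] fac[OF _ occ2] by auto
    \<comment> \<open>Here all occurrences of the variables of \<open>u\<close> lie in
      \<open>u\<close>, so \<open>u\<close> is itself doubled and cannot be erased entirely.\<close>
    have u: "\<exists>v\<in>set u. h' v \<noteq> []" if "x \<notin> set u \<and> y \<notin> set u"
    proof (rule ccontr)
      assume "\<not> (\<exists>v\<in>set u. h' v \<noteq> [])"
      then have "distinct u" using dis[OF _ occ3] by auto
      moreover have "doubled u"
        using less.prems(1) that by (auto simp: doubled_def split: if_splits)
      ultimately show False using doubled_distinct_Nil less.prems(2) by blast
    qed
    have nonempty: "filter ?P ?\<phi> \<noteq> []"
    proof
      assume "filter ?P ?\<phi> = []"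
      then have all: "\<forall>v\<in>set ?\<phi>. h' v = []" by (simp only: filter_empty_conv) blast
      then have "distinct (x # u)" "distinct (u @ [y])" using dis[OF _ occ1] dis[OF _ occ2] by auto
      then show False using u all by auto
    qed
    have "card (set (filter ?P ?\<phi>)) \<le> card (set ?\<phi>)" by (intro card_mono) auto
    then have card: "card (set (filter ?P ?\<phi>)) + 2 \<le> m" using less.prems(4) by linarith
    have dbl: "doubled (filter ?P ?\<phi>)" using doubled_filter less.prems(1) by blast
    \<comment> \<open>Filtering out erased variables leaves the image unchanged and makes
      \<open>h'\<close> nonerasing on what remains.\<close>
    have no: "\<not> factor_of (morph h' ?\<phi>) ?w"
      using doubled_not_factor_of_block_word[OF dbl nonempty _ card, of h']
      unfolding morph_filter_nonerased set_filter by blast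
    have x: "h' x \<noteq> []" using no fac2 by auto
    have y: "h' y \<noteq> []" using no fac1 by auto
    have fil: "filter ?P ?\<phi> = x # filter ?P u @ [y]" using x y by simp
    \<comment> \<open>If \<open>x\<close> or \<open>y\<close> occurs in \<open>u\<close>, it
      survives there; otherwise the fact \<open>u\<close> applies.\<close>
    have "filter ?P u \<noteq> []" using u x y by (auto simp: filter_empty_conv)
    moreover have "length (morph h' (x # filter ?P u @ [y])) < length (morph h ?\<phi>)"
      unfolding fil[symmetric] morph_filter_nonerased using length_morph_less lt by blast
    moreover have "h' v \<noteq> []" if "v \<in> set (x # filter ?P u @ [y])" for v
      using that x y by auto
    ultimately have "\<not> (factor_of (morph h' (x # filter ?P u)) ?w \<and>
        factor_of (morph h' (filter ?P u @ [y])) ?w)"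
      using less.hyps[of h' "filter ?P u"] dbl card unfolding fil by blast
    then show False using fac1 fac2 by (simp add: morph_filter_nonerased)
  qed
qed

section \<open>Single-fragment formulas\<close>

lemma avoidable_if_avoided_by_block_word:
  assumes "2 \<le> m" "\<And>h. (\<And>v. h v \<noteq> []) \<Longrightarrow> \<exists>\<phi>\<in>f. \<not> factor_of (morph h \<phi>) (block_word m)"
  shows "avoidable f"
  unfolding avoidable_def occurrence_def
proof (intro exI conjI)
  show "finite {..<m * m}" by simp
  show "range (block_word m) \<subseteq> {..<m * m}" using block_word_less[OF assms(1)] by auto
  show "\<nexists>h. (\<forall>v. h v \<in> lists {..<m * m} \<and> h v \<noteq> []) \<and>
      (\<forall>\<phi>\<in>f. factor_of (morph h \<phi>) (block_word m))"
    using assms(2) by blast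
qed

lemma avoidable_square: "avoidable {[a, a]}"
\<comment> \<open>One variable plus the two required by the bound on \<open>m\<close>.\<close>
proof (rule avoidable_if_avoided_by_block_word[of 3])
  fix h :: "'a \<Rightarrow> nat list" assume "\<And>v. h v \<noteq> []"
  then have "\<not> factor_of (morph h [a, a]) (block_word 3)"
    by (intro doubled_not_factor_of_block_word) (simp_all add: doubled_def)
  then show "\<exists>\<phi>\<in>{[a, a]}. \<not> factor_of (morph h \<phi>) (block_word 3)" by simp
qed simp

text \<open>This formula is what splitting a square gives.\<close>

lemma not_avoidable_letter: "\<not> avoidable {[a]}"
proof
  assume "avoidable {[a]}"
  then obtain S and w :: "nat \<Rightarrow> nat" where w: "range w \<subseteq> S" "\<nexists>h. occurrence S h {[a]} w"
    unfolding avoidable_def by blast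
  have "occurrence S (\<lambda>_. [w 0]) {[a]} w"
    using w(1) by (auto simp: occurrence_def factor_of_def intro!: exI[of _ 0])
  then show False using w(2) by blast
qed

lemma avoidable_split_doubled:
  assumes "doubled (x # u @ [y])" "u \<noteq> []"
  shows "avoidable {x # u, u @ [y]}"
proof (rule avoidable_if_avoided_by_block_word[of "card (set (x # u @ [y])) + 2"])
  fix h :: "'a \<Rightarrow> nat list" assume "\<And>v. h v \<noteq> []"
  then show "\<exists>\<phi>\<in>{x # u, u @ [y]}.
      \<not> factor_of (morph h \<phi>) (block_word (card (set (x # u @ [y])) + 2))"
    using split_doubled_not_factors_of_block_word[OF assms, of h] by blast
qed simp

theorem theorem8:
  fixes f :: "'v list set" and A :: 'v
  shows "formula f \<and> card f = 1 \<and> minimally_avoidable f \<longleftrightarrow> renaming_of f {[A, A]}"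
proof
  assume f: "formula f \<and> card f = 1 \<and> minimally_avoidable f"
  then obtain \<phi> where \<phi>: "f = {\<phi>}" by (meson card_1_singletonE)
  have "doubled \<phi>" and "\<phi> \<noteq> []"
    using f by (auto simp: \<phi> formula_def vars_def doubled_def)
  have "\<not> avoidable {butlast \<phi>, tl \<phi>}"
    using f by (simp add: \<phi> minimally_avoidable_def split_on_def)
  obtain x \<psi> where \<psi>: "\<phi> = x # \<psi>" using \<open>\<phi> \<noteq> []\<close> by (cases \<phi>) auto
  then have "\<psi> \<noteq> []" using \<open>doubled \<phi>\<close> by (auto simp: doubled_def)
  then obtain u y where u: "\<phi> = x # u @ [y]" using \<psi> by (cases \<psi> rule: rev_cases) auto
  then have "u = []"
    using avoidable_split_doubled[of x u y] \<open>doubled \<phi>\<close> \<open>\<not> avoidable {butlast \<phi>, tl \<phi>}\<close>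
    by (auto simp: butlast_append)
  then have "\<phi> = [x, x]" using \<open>doubled \<phi>\<close> u by (auto simp: doubled_def split: if_splits)
  \<comment> \<open>A constant map is bijective between the one-element sets of variables.\<close>
  then show "renaming_of f {[A, A]}"
    unfolding renaming_of_def vars_def \<phi> by (intro exI[of _ "\<lambda>_. x"]) (simp add: bij_betw_def)
next
  assume "renaming_of f {[A, A]}"
  then obtain a where f: "f = {[a, a]}" by (auto simp: renaming_of_def)
  have "formula f" by (simp add: f formula_def vars_def)
  moreover have "minimally_avoidable f"
    using avoidable_square[of a] not_avoidable_letter[of a]
    by (simp add: f minimally_avoidable_def split_on_def)
  ultimately show "formula f \<and> card f = 1 \<and> minimally_avoidable f" by (simp add: f)
qed

end
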